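(* Let $B > 1$ be an integer. Let $(u(n))_{n \geq 0}$ be a strongly $B$-multiplicative sequence of complex numbers, different from the sequence $(1,0,0,\ldots)$, with $|u(n)| \leq 1$ for all $n \geq 0$ and $\left|\sum_{0 \leq k < B} u(k)\right| < B$. Let $f$ be a map from the nonnegative integers to the complex numbers with $|f(n+1) - f(n)| = \mathcal{O}(n^{-2})$. For $k = 0, 1, \ldots, B-1$ define $$S(k, B, u, f) := \sum_{n \geq 0} u(n) f(Bn+k).$$ Then $$\sum_{n \geq 0} u(n) f(n) = \sum_{0 \leq k \leq B-1} u(k) S(k, B, u, f)$$ and $$\sum_{n \geq 0} u(n) \sum_{0 \leq k \leq B-1} f(Bn+k) = \sum_{0 \leq k \leq B-1} S(k, B, u, f).$$ Moreover, for $k = 0, 1, \ldots, B-1$ define $$S_1(k, B, u) := \sum_{n \geq \delta_k} \frac{u(n)}{Bn+k}, \qquad S_2(k, B, u) := \sum_{n \geq \delta_k} \frac{u(n)}{(Bn+k)(Bn+k+1)},$$ where $\delta_k = 1$ if $k=0$ and $\delta_k = 0$ otherwise. Then $$(B-1) S_1(0, B, u) - \sum_{1 \leq k \leq B-1} u(k) S_1(k, B, u) = 0$$ and $$\sum_{0 \leq k \leq B-1} (B - u(k)) S_2(k, B, u) = B - 1.$$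
   Context: A sequence of complex numbers $(u(n))_{n \geq 0}$ is called strongly $B$-multiplicative (for an integer $B \geq 2$) if $u(0)=1$ and, for all $n \geq 0$ and all $k \in \{0, 1, \ldots, B-1\}$, $u(Bn + k) = u(n) u(k)$. All series in the statement converge under the hypotheses.
   Formalization: The hypothesis that f(n) tends to 0 is added; without it the series involving f diverge (e.g. B = 2, u the ±1 Thue–Morse sequence, f = 1), and it is exactly the condition under which they converge. *)

theory Defs
  imports Complex_Main "HOL-Library.Landau_Symbols"
begin

definition strongly_multiplicative :: "nat \<Rightarrow> (nat \<Rightarrow> complex) \<Rightarrow> bool" where
  "strongly_multiplicative B u \<longleftrightarrow>
     u 0 = 1 \<and> (\<forall>n. \<forall>k\<in>{0..<B}. u (B * n + k) = u n * u k)"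

text \<open>
  The series below are in general only conditionally convergent, so they are ordered sums
  (limits of partial sums). A sum over \<open>n \<ge> \<delta>\<close> is written with the index shifted by \<open>\<delta>\<close>.
  The terms are named so that their summability can be stated: \<^const>\<open>suminf\<close> says
  nothing about convergence.
\<close>

definition \<delta> :: "nat \<Rightarrow> nat" where
  "\<delta> k = (if k = 0 then 1 else 0)"

definition S_term :: "nat \<Rightarrow> nat \<Rightarrow> (nat \<Rightarrow> complex) \<Rightarrow> (nat \<Rightarrow> complex) \<Rightarrow> nat \<Rightarrow> complex" where
  "S_term k B u f n = u n * f (B * n + k)"

definition S :: "nat \<Rightarrow> nat \<Rightarrow> (nat \<Rightarrow> complex) \<Rightarrow> (nat \<Rightarrow> complex) \<Rightarrow> complex" where
  "S k B u f = (\<Sum>n. S_term k B u f n)"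

definition S1_term :: "nat \<Rightarrow> nat \<Rightarrow> (nat \<Rightarrow> complex) \<Rightarrow> nat \<Rightarrow> complex" where
  "S1_term k B u n = u n / of_nat (B * n + k)"

definition S1 :: "nat \<Rightarrow> nat \<Rightarrow> (nat \<Rightarrow> complex) \<Rightarrow> complex" where
  "S1 k B u = (\<Sum>n. S1_term k B u (n + \<delta> k))"

definition S2_term :: "nat \<Rightarrow> nat \<Rightarrow> (nat \<Rightarrow> complex) \<Rightarrow> nat \<Rightarrow> complex" where
  "S2_term k B u n = u n / (of_nat (B * n + k) * of_nat (B * n + k + 1))"

definition S2 :: "nat \<Rightarrow> nat \<Rightarrow> (nat \<Rightarrow> complex) \<Rightarrow> complex" where
  "S2 k B u = (\<Sum>n. S2_term k B u (n + \<delta> k))"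

text \<open>
  The condition \<open>\<bar>f (n + 1) - f n\<bar> = O(1 / n\<^sup>2)\<close> alone only gives that \<open>f\<close> converges.
  If moreover \<open>\<bar>u n\<bar> \<le> 1\<close> and \<open>\<bar>\<Sum>k<B. u k\<bar> < B\<close>, then \<open>\<Sum>n. u n * f n\<close> converges
  exactly when the limit of \<open>f\<close> is \<open>0\<close>: for a strongly
  \<open>B\<close>-multiplicative \<open>u\<close> other than \<open>(1, 0, 0, \<dots>)\<close> some digit \<open>k > 0\<close> has \<open>u k \<noteq> 0\<close>, and
  \<open>u (k * B ^ j) = u k\<close> for all \<open>j\<close>, so \<open>u\<close> does not tend to \<open>0\<close>. Hence \<open>f \<longlonglongrightarrow> 0\<close> has to be
  assumed as well.
\<close>

end

theory Submission
  imports Defs "HOL-Analysis.Summation_Tests" "HOL-Real_Asymp.Real_Asymp"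
begin

text \<open>
  The partial sums \<open>U\<close> of \<open>u\<close> satisfy
  \<open>U (B * n + r) = U B * U n + u n * U r\<close> for \<open>r < B\<close>. Since \<open>\<bar>U B\<bar> < B\<close>, this recursion gives
  \<open>U n = O(n powr \<alpha>)\<close> with some \<open>\<alpha> < 1\<close>, and summation by parts then yields convergence of
  \<open>\<Sum>n. u n * f n\<close>. Grouping the terms in blocks of length \<open>B\<close> gives the first two identities;
  the last two are the cases \<open>f n = 1 / n\<close> and \<open>f n = 1 / (n * (n + 1))\<close>,
  with \<open>f 0 = 0\<close> through division by zero.
\<close>

section \<open>Convergence criterion from summation by parts\<close>

text \<open>Since 1/(n+2)^2 is at most 1/(n+1) - 1/(n+2), the sequence
  \<open>norm (f (Suc n)) - K / real (Suc n)\<close> is increasing. Its limit is 0, so it is nowhere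
  positive.\<close>

lemma norm_le_of_increment_bound:
  fixes f :: "nat \<Rightarrow> 'a :: real_normed_vector"
  assumes f: "f \<longlonglongrightarrow> 0"
    and K: "\<And>n. norm (f (Suc n) - f n) \<le> K / (real n + 1)\<^sup>2"
  shows "norm (f (Suc n)) \<le> K / real (Suc n)"
proof -
  have "0 \<le> norm (f (Suc 0) - f 0)" by simp
  also have "\<dots> \<le> K" using K[of 0] by simp
  finally have K0: "0 \<le> K" .
  define h where "h n = norm (f (Suc n)) - K / real (Suc n)" for n
  have "h n \<le> h (Suc n)" for n
  proof -
    have "norm (f (Suc n)) \<le> norm (f (Suc (Suc n))) + norm (f (Suc (Suc n)) - f (Suc n))"
      by (metis norm_minus_commute norm_triangle_sub)
    also have "norm (f (Suc (Suc n)) - f (Suc n)) \<le> K / (real (Suc n) + 1)\<^sup>2"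
      by (rule K)
    also have "\<dots> \<le> K / (real (Suc n) * real (Suc (Suc n)))"
      using K0 by (intro divide_left_mono mult_pos_pos zero_less_power)
        (auto simp: power2_eq_square algebra_simps)
    also have "\<dots> = K / real (Suc n) - K / real (Suc (Suc n))"
      by (simp add: divide_simps) (simp add: algebra_simps)
    finally show ?thesis unfolding h_def by simp
  qed
  then have "incseq h" by (rule incseq_SucI)
  moreover have "h \<longlonglongrightarrow> 0 - 0"
    unfolding h_def
    by (intro tendsto_diff tendsto_norm_zero LIMSEQ_Suc[OF f])
       (rule real_tendsto_divide_at_top[OF tendsto_const], rule filterlim_compose[OF filterlim_real_sequentially filterlim_Suc])
  ultimately have "h n \<le> 0 - 0" by (rule incseq_le)
  then show ?thesis by (simp add: h_def)
qed

text \<open>A step of length \<open>B\<close> consists of \<open>B\<close> unit steps, each starting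
  at an index at least \<open>n\<close>. Thus the increment condition passes from \<open>f\<close>
  to its restriction to a residue class modulo \<open>B\<close>, at the cost of a factor
  \<open>B\<close>.\<close>

lemma increment_bound_subsequence:
  fixes f :: "nat \<Rightarrow> 'a :: real_normed_vector"
  assumes "B > 0" "K \<ge> 0"
    and K: "\<And>n. norm (f (Suc n) - f n) \<le> K / (real n + 1)\<^sup>2"
  shows "norm (f (B * Suc n + k) - f (B * n + k)) \<le> real B * K / (real n + 1)\<^sup>2"
proof -
  have "f (B * Suc n + k) - f (B * n + k) = (\<Sum>j<B. f (B * n + k + Suc j) - f (B * n + k + j))"
    by (subst sum_lessThan_telescope) (simp add: algebra_simps)
  also have "norm \<dots> \<le> (\<Sum>j<B. K / (real n + 1)\<^sup>2)"
  proof (intro sum_norm_le)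
    fix j assume "j \<in> {..<B}"
    have "n \<le> B * n + k + j" using assms(1) by (simp add: trans_le_add1)
    then have n: "real n \<le> real (B * n + k + j)" by (rule of_nat_mono)
    have "norm (f (B * n + k + Suc j) - f (B * n + k + j)) \<le> K / (real (B * n + k + j) + 1)\<^sup>2"
      using K[of "B * n + k + j"] by simp
    also have "\<dots> \<le> K / (real n + 1)\<^sup>2"
      using n assms(2) by (intro divide_left_mono power_mono mult_pos_pos) auto
    finally show "norm (f (B * n + k + Suc j) - f (B * n + k + j)) \<le> K / (real n + 1)\<^sup>2" .
  qed
  finally show ?thesis by simp
qed

lemma sum_lessThan_add:
  fixes g :: "nat \<Rightarrow> 'a :: comm_monoid_add"
  shows "(\<Sum>m<a + r. g m) = (\<Sum>m<a. g m) + (\<Sum>j<r. g (a + j))"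
  by (induction r) (simp_all add: add.assoc)

lemma summation_by_parts:
  fixes u f :: "nat \<Rightarrow> 'a :: comm_ring_1"
  shows "(\<Sum>n<N. u n * f n) = (\<Sum>n<N. u n) * f N - (\<Sum>n<N. (\<Sum>m<Suc n. u m) * (f (Suc n) - f n))"
  by (induction N) (simp_all add: algebra_simps)

text \<open>After summation by parts the boundary term is O(N powr (\<alpha> - 1)) and tends to 0.
  The remaining series has terms O(n powr (\<alpha> - 2)) and converges absolutely because \<alpha>
  - 2 < -1.\<close>

lemma summable_of_partial_sums_powr:
  fixes u f :: "nat \<Rightarrow> complex"
  assumes \<alpha>: "\<alpha> < 1" and U: "\<And>N. norm (\<Sum>n<N. u n) \<le> C * real N powr \<alpha>"
    and f: "f \<longlonglongrightarrow> 0"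
    and K: "\<And>n. norm (f (Suc n) - f n) \<le> K / (real n + 1)\<^sup>2"
  shows "summable (\<lambda>n. u n * f n)"
proof -
  define U where "U N = (\<Sum>n<N. u n)" for N
  have U': "norm (U N) \<le> C * real N powr \<alpha>" for N using U by (simp add: U_def)
  have C0: "C \<ge> 0" using order_trans[OF norm_ge_zero U[of 1]] by simp
  \<comment> \<open>The index is shifted because the decay bound on \<open>f\<close> starts at index
    1.\<close>
  have "(\<lambda>n. U (Suc n) * f (Suc n)) \<longlonglongrightarrow> 0"
  proof (rule Lim_null_comparison)
    show "\<forall>\<^sub>F n in sequentially. norm (U (Suc n) * f (Suc n)) \<le> C * K * real (Suc n) powr (\<alpha> - 1)"
    proof (rule always_eventually, rule allI)
      fix n
      have "norm (U (Suc n) * f (Suc n)) \<le> (C * real (Suc n) powr \<alpha>) * (K / real (Suc n))"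
        unfolding norm_mult using C0
        by (intro mult_mono U' norm_le_of_increment_bound[OF f K]) auto
      then show "norm (U (Suc n) * f (Suc n)) \<le> C * K * real (Suc n) powr (\<alpha> - 1)"
        by (simp add: powr_diff mult_ac)
    qed
    have "(\<lambda>n. real (Suc n) powr (\<alpha> - 1)) \<longlonglongrightarrow> 0"
      using \<alpha> by (intro tendsto_neg_powr filterlim_compose[OF filterlim_real_sequentially filterlim_Suc]) auto
    then show "(\<lambda>n. C * K * real (Suc n) powr (\<alpha> - 1)) \<longlonglongrightarrow> 0"
      by (rule tendsto_mult_right_zero)
  qed
  then have lim: "(\<lambda>n. U n * f n) \<longlonglongrightarrow> 0" by (rule LIMSEQ_imp_Suc)
  have "summable (\<lambda>n. U (Suc n) * (f (Suc n) - f n))"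
  proof (rule summable_comparison_test')
    have "summable (\<lambda>n. real n powr (\<alpha> - 2))"
      using \<alpha> by (simp add: summable_real_powr_iff)
    then have "summable (\<lambda>n. real (Suc n) powr (\<alpha> - 2))" by (subst summable_Suc_iff)
    then show "summable (\<lambda>n. C * K * real (Suc n) powr (\<alpha> - 2))" by (rule summable_mult)
    fix n
    have "norm (U (Suc n) * (f (Suc n) - f n)) \<le> (C * real (Suc n) powr \<alpha>) * (K / (real n + 1)\<^sup>2)"
      unfolding norm_mult using C0 by (intro mult_mono U' K) auto
    also have "real n + 1 = real (Suc n)" by simp
    finally show "norm (U (Suc n) * (f (Suc n) - f n)) \<le> C * K * real (Suc n) powr (\<alpha> - 2)"
      by (simp add: powr_diff powr_numeral mult_ac)
  qed
  then have "(\<lambda>N. U N * f N - (\<Sum>n<N. U (Suc n) * (f (Suc n) - f n)))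
      \<longlonglongrightarrow> 0 - (\<Sum>n. U (Suc n) * (f (Suc n) - f n))"
    by (intro tendsto_diff lim summable_LIMSEQ)
  then have "(\<lambda>n. u n * f n) sums (0 - (\<Sum>n. U (Suc n) * (f (Suc n) - f n)))"
    unfolding sums_def summation_by_parts[of u f] U_def .
  then show ?thesis by (rule sums_summable)
qed

section \<open>The two sequences behind \<open>S1\<close> and \<open>S2\<close>\<close>

lemma reciprocal_diff:
  fixes n :: nat
  assumes "n > 0"
  shows "1 / of_nat n - 1 / of_nat (Suc n) = (1 / (of_nat n * of_nat (n + 1)) :: 'a :: field_char_0)"
proof -
  have "(of_nat n :: 'a) \<noteq> 0" "(of_nat (n + 1) :: 'a) \<noteq> 0"
    using assms by (simp_all only: of_nat_eq_0_iff)
  then show ?thesis by (simp add: divide_simps)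
qed

text \<open>These facts make the convergence criterion applicable to both sequences. Division by
  zero gives \<open>f 0 = g 0 = 0\<close>, so the increments at \<open>n = 0\<close> are 1 and 1/2.
  The constant 2 is attained by \<open>f\<close> at \<open>n = 1\<close>.\<close>

lemma reciprocal_increment_bounds:
  defines "f \<equiv> \<lambda>n. 1 / of_nat n :: complex"
    and "g \<equiv> \<lambda>n. 1 / (of_nat n * of_nat (n + 1)) :: complex"
  shows "f \<longlonglongrightarrow> 0" "norm (f (Suc n) - f n) \<le> 2 / (real n + 1)\<^sup>2"
    and "g \<longlonglongrightarrow> 0" "norm (g (Suc n) - g n) \<le> 2 / (real n + 1)\<^sup>2"
proof -
  show f: "f \<longlonglongrightarrow> 0"
    unfolding f_def using lim_1_over_n[where 'a = complex] by simp
  have "(\<lambda>n. f n * f (Suc n)) \<longlonglongrightarrow> 0 * 0"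
    by (intro tendsto_mult f LIMSEQ_Suc[OF f])
  then show "g \<longlonglongrightarrow> 0" by (simp add: f_def g_def)
  have *: "1 / (x * (x + 1)) \<le> 2 / (x + 1)\<^sup>2" "2 / (x * (x + 1) * (x + 2)) \<le> 2 / (x + 1)\<^sup>2"
    if "x \<ge> 1" for x :: real
  proof -
    have "1 * 1 \<le> x * x" using that by (intro mult_mono) auto
    then show "1 / (x * (x + 1)) \<le> 2 / (x + 1)\<^sup>2"
      using that by (simp add: divide_simps) (simp add: power2_eq_square algebra_simps)
    have "(x + 1)\<^sup>2 \<le> (x * (x + 1)) * (x + 2)"
    proof -
      have "(x + 1) * 1 * (x + 1) \<le> (x + 1) * x * (x + 2)"
        using that by (intro mult_mono) auto
      then show ?thesis by (simp add: power2_eq_square algebra_simps)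
    qed
    then show "2 / (x * (x + 1) * (x + 2)) \<le> 2 / (x + 1)\<^sup>2"
      using that by (intro divide_left_mono) auto
  qed
  show "norm (f (Suc n) - f n) \<le> 2 / (real n + 1)\<^sup>2"
  proof (cases "n = 0")
    case False
    then have "f n - f (Suc n) = 1 / (of_nat n * of_nat (n + 1))"
      unfolding f_def by (intro reciprocal_diff) simp
    then have "norm (f (Suc n) - f n) = 1 / (real n * (real n + 1))"
      by (subst norm_minus_commute) (simp only: norm_divide norm_mult norm_of_nat norm_one, simp)
    then show ?thesis using *(1)[of "real n"] False by simp
  qed (simp add: f_def)
  show "norm (g (Suc n) - g n) \<le> 2 / (real n + 1)\<^sup>2"
  proof (cases "n = 0")
    case False
    have nz: "(of_nat n :: complex) \<noteq> 0" "(of_nat (n + 1) :: complex) \<noteq> 0"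
        "(of_nat (n + 2) :: complex) \<noteq> 0"
      using False by (auto simp del: of_nat_Suc of_nat_add)
    have "g n - g (Suc n) = 2 / (of_nat n * of_nat (n + 1) * of_nat (n + 2))"
    proof -
      have "1 / (x * y) - 1 / (y * z) = (z - x) / (x * y * z)"
        if "x \<noteq> 0" "y \<noteq> 0" "z \<noteq> 0" for x y z :: complex
        using that by (simp add: divide_simps)
      from this[OF nz] show ?thesis by (simp add: g_def)
    qed
    then have "norm (g (Suc n) - g n) = 2 / (real n * (real n + 1) * (real n + 2))"
      by (subst norm_minus_commute)
        (simp only: norm_divide norm_mult norm_of_nat norm_numeral, simp add: add.commute)
    then show ?thesis using *(2)[of "real n"] False by simp
  qed (simp add: g_def)
qed

section \<open>Growth of the partial sums of \<open>u\<close>\<close>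

locale bounded_strongly_multiplicative =
  fixes B :: nat and u :: "nat \<Rightarrow> complex"
  assumes B: "B > 1"
    and u: "strongly_multiplicative B u"
    and norm_le_1: "cmod (u n) \<le> 1"
    and digit_sum: "cmod (\<Sum>k<B. u k) < real B"
begin

lemma u_0 [simp]: "u 0 = 1"
  using u by (simp add: strongly_multiplicative_def)

lemma u_digit: "k < B \<Longrightarrow> u (B * n + k) = u n * u k"
  using u by (simp add: strongly_multiplicative_def)

text \<open>By multiplicativity, the block of indices with quotient \<open>n\<close> contributes
  \<open>u n\<close> times the digit sum.\<close>

lemma partial_sum_block: "(\<Sum>m<B * n. u m) = (\<Sum>k<B. u k) * (\<Sum>m<n. u m)"
proof (induction n)
  case (Suc n)
  have "(\<Sum>m<B * Suc n. u m) = (\<Sum>m<B * n + B. u m)" by (simp add: add.commute)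
  also have "\<dots> = (\<Sum>m<B * n. u m) + (\<Sum>k<B. u (B * n + k))" by (rule sum_lessThan_add)
  also have "(\<Sum>k<B. u (B * n + k)) = (\<Sum>k<B. u k) * u n"
    unfolding sum_distrib_right by (intro sum.cong) (simp_all add: u_digit mult.commute)
  finally show ?case unfolding Suc.IH by (simp only: sum.lessThan_Suc distrib_left)
qed simp

lemma partial_sum_growth:
  "\<exists>\<alpha> C. \<alpha> < 1 \<and> (\<forall>N. cmod (\<Sum>n<N. u n) \<le> C * real N powr \<alpha>)"
proof -
  \<comment> \<open>Any \<sigma> below \<open>B\<close> gives \<alpha> < 1. Keeping it above 1 as
    well makes \<alpha> positive and allows division by \<open>\<sigma> - 1\<close>, even if the
    digit sum is small.\<close>
  obtain \<sigma> where \<sigma>: "max 1 (cmod (\<Sum>k<B. u k)) < \<sigma>" "\<sigma> < real B"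
    using dense[of "max 1 (cmod (\<Sum>k<B. u k))" "real B"] digit_sum B by auto
  define \<alpha> where "\<alpha> = log (real B) \<sigma>"
  have "\<alpha> < 1" "0 < \<alpha>" using \<sigma> B by (auto simp: \<alpha>_def)
  have B\<alpha>: "real B powr \<alpha> = \<sigma>" using \<sigma> B by (simp add: \<alpha>_def)
  \<comment> \<open>\<open>D\<close> satisfies \<open>\<sigma> * D = D + B\<close>, so subtracting it absorbs the error \<open>B\<close> of one
    recursion step.\<close>
  define D where "D = real B / (\<sigma> - 1)"
  have D: "\<sigma> * D = D + real B" "D \<ge> 0" using \<sigma> by (auto simp: D_def field_simps)
  \<comment> \<open>\<open>N = 0\<close> is excluded: the right-hand side is then
    \<open>- D\<close>, which is negative.\<close>
  have main: "cmod (\<Sum>n<N. u n) \<le> (real B + D) * real N powr \<alpha> - D" if "N > 0" for N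
    using that
  proof (induction N rule: less_induct)
    case (less N)
    show ?case
    proof (cases "N < B")
      case True
      have "cmod (\<Sum>n<N. u n) \<le> (\<Sum>n<N. 1)" by (intro sum_norm_le norm_le_1)
      also have "\<dots> \<le> real B" using True by simp
      also have "\<dots> \<le> (real B + D) * 1 - D" by simp
      also have "\<dots> \<le> (real B + D) * real N powr \<alpha> - D"
        using less.prems D(2) \<open>0 < \<alpha>\<close> by (intro diff_right_mono mult_left_mono ge_one_powr_ge_zero) auto
      finally show ?thesis .
    next
      case False
      define n r where "n = N div B" and "r = N mod B"
      have N: "N = B * n + r" and r: "r < B" using B by (auto simp: n_def r_def)
      have n: "n > 0" "n < N" using False B less.prems by (auto simp: n_def div_greater_zero_iff)
      have "(\<Sum>m<N. u m) = (\<Sum>k<B. u k) * (\<Sum>m<n. u m) + (\<Sum>j<r. u (B * n + j))"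
        unfolding N sum_lessThan_add partial_sum_block ..
      also have "cmod \<dots> \<le> cmod (\<Sum>k<B. u k) * cmod (\<Sum>m<n. u m) + (\<Sum>j<r. 1)"
        by (intro norm_triangle_mono sum_norm_le norm_le_1) (simp add: norm_mult)
      also have "\<dots> \<le> \<sigma> * ((real B + D) * real n powr \<alpha> - D) + real B"
        using \<sigma> r less.IH[OF n(2,1)] by (intro add_mono mult_mono) auto
      also have "\<dots> = (real B + D) * (real B * real n) powr \<alpha> - D"
        using D(1) by (simp add: powr_mult B\<alpha>) (simp add: algebra_simps)
      also have "\<dots> \<le> (real B + D) * real N powr \<alpha> - D"
        using D(2) \<open>0 < \<alpha>\<close> by (intro diff_right_mono mult_left_mono powr_mono2) (auto simp: N)
      finally show ?thesis .
    qed
  qed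
  have "cmod (\<Sum>n<N. u n) \<le> (real B + D) * real N powr \<alpha>" for N
    using main[of N] D(2) by (cases "N = 0") auto
  with \<open>\<alpha> < 1\<close> show ?thesis by blast
qed

lemma summable_mult_slowly_varying:
  assumes "f \<longlonglongrightarrow> 0" "\<And>n. cmod (f (Suc n) - f n) \<le> K / (real n + 1)\<^sup>2"
  shows "summable (\<lambda>n. u n * f n)"
proof -
  obtain \<alpha> C where "\<alpha> < 1" and U: "\<forall>N. cmod (\<Sum>n<N. u n) \<le> C * real N powr \<alpha>"
    using partial_sum_growth by (elim exE conjE)
  show ?thesis
    by (rule summable_of_partial_sums_powr[OF \<open>\<alpha> < 1\<close> _ assms]) (rule U[rule_format])
qed

section \<open>Splitting series by the last base-\<open>B\<close> digit\<close>

context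
  fixes f :: "nat \<Rightarrow> complex" and K :: real
  assumes f: "f \<longlonglongrightarrow> 0" and K: "\<And>n. cmod (f (Suc n) - f n) \<le> K / (real n + 1)\<^sup>2"
begin

lemma summable_S_term: "summable (S_term k B u f)"
proof -
  have "K \<ge> 0" using order_trans[OF norm_ge_zero K[of 0]] by simp
  have "strict_mono (\<lambda>n. B * n + k)" using B by (intro strict_monoI) simp
  then have "(\<lambda>n. f (B * n + k)) \<longlonglongrightarrow> 0"
    using LIMSEQ_subseq_LIMSEQ[OF f] by (simp add: comp_def)
  then have "summable (\<lambda>n. u n * f (B * n + k))"
    using increment_bound_subsequence[OF _ \<open>K \<ge> 0\<close> K] B
    by (intro summable_mult_slowly_varying[where K = "real B * K"]) auto
  then show ?thesis by (simp add: S_term_def[abs_def])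
qed

lemma S_term_sums: "S_term k B u f sums S k B u f"
  unfolding S_def by (intro summable_sums summable_S_term)

text \<open>Only consecutive terms are grouped, which preserves the sum of a conditionally
  convergent series. In each block \<open>u (B * n + k)\<close> factors as \<open>u n * u k\<close>,
  and the resulting finite sum over \<open>k\<close> may be exchanged with the series because every
  \<open>S_term\<close> series converges.\<close>

lemma sums_digit_split: "(\<lambda>n. u n * f n) sums (\<Sum>k<B. u k * S k B u f)"
proof -
  have s: "(\<lambda>n. u n * f n) sums (\<Sum>n. u n * f n)"
    by (intro summable_sums summable_mult_slowly_varying[OF f K])
  have "(\<lambda>n. \<Sum>k<B. u k * S_term k B u f n) sums (\<Sum>n. u n * f n)"
  proof -
    have "(\<Sum>m\<in>{n * B..<n * B + B}. u m * f m) = (\<Sum>k<B. u k * S_term k B u f n)" for n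
      using sum.shift_bounds_nat_ivl[of "\<lambda>m. u m * f m" 0 "n * B" B]
      by (auto simp: atLeast0LessThan add.commute mult.commute[of _ B] S_term_def
          u_digit[unfolded add.commute[of "B * _"]] intro!: sum.cong)
    then show ?thesis using sums_group[OF s, of B] B by simp
  qed
  moreover have "(\<lambda>n. \<Sum>k<B. u k * S_term k B u f n) sums (\<Sum>k<B. u k * S k B u f)"
    by (intro sums_sum sums_mult S_term_sums)
  ultimately have "(\<Sum>n. u n * f n) = (\<Sum>k<B. u k * S k B u f)"
    by (rule sums_unique2)
  with s show ?thesis by simp
qed

lemma sums_block_sum: "(\<lambda>n. u n * (\<Sum>k<B. f (B * n + k))) sums (\<Sum>k<B. S k B u f)"
proof -
  have "(\<lambda>n. \<Sum>k<B. S_term k B u f n) sums (\<Sum>k<B. S k B u f)"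
    by (intro sums_sum S_term_sums)
  then show ?thesis by (simp add: S_term_def sum_distrib_left)
qed

end

section \<open>The identities for \<open>S1\<close> and \<open>S2\<close>\<close>

text \<open>Dropping the term at \<open>n = 0\<close> when \<open>k = 0\<close> is harmless, since
  division by zero makes that term 0. This identifies \<open>S1\<close> and \<open>S2\<close> with
  values of \<open>S\<close>.\<close>

lemma sums_from_\<delta>:
  assumes "g sums s" "k = 0 \<Longrightarrow> g 0 = (0 :: complex)"
  shows "(\<lambda>n. g (n + \<delta> k)) sums s"
  using assms by (cases "k = 0") (simp_all add: \<delta>_def sums_Suc_iff)

lemma S1_sums: "(\<lambda>n. S1_term k B u (n + \<delta> k)) sums S k B u (\<lambda>n. 1 / of_nat n)"
proof (rule sums_from_\<delta>)
  show "S1_term k B u sums S k B u (\<lambda>n. 1 / of_nat n)"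
    using S_term_sums[OF reciprocal_increment_bounds(1,2), of k]
    by (simp add: S_term_def[abs_def] S1_term_def[abs_def])
qed (simp add: S1_term_def)

lemma S2_sums:
  "(\<lambda>n. S2_term k B u (n + \<delta> k)) sums S k B u (\<lambda>n. 1 / (of_nat n * of_nat (n + 1)))"
proof (rule sums_from_\<delta>)
  show "S2_term k B u sums S k B u (\<lambda>n. 1 / (of_nat n * of_nat (n + 1)))"
    using S_term_sums[OF reciprocal_increment_bounds(3,4), of k]
    by (simp add: S_term_def[abs_def] S2_term_def[abs_def])
qed (simp add: S2_term_def)

lemma S1_eq: "S1 k B u = S k B u (\<lambda>n. 1 / of_nat n)"
  unfolding S1_def by (rule sums_unique[OF S1_sums, symmetric])

lemma S2_eq: "S2 k B u = S k B u (\<lambda>n. 1 / (of_nat n * of_nat (n + 1)))"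
  unfolding S2_def by (rule sums_unique[OF S2_sums, symmetric])

text \<open>For \<open>f n = 1 / n\<close> the series of \<open>u n * f n\<close> has two
  evaluations: the digit split, and \<open>B * S1 0 B u\<close>, because
  \<open>1 / n = B * (1 / (B * n))\<close>. The \<open>k = 0\<close> term of the split has
  coefficient \<open>u 0 = 1\<close> and is moved to the other side.\<close>

lemma S1_identity: "(of_nat B - 1) * S1 0 B u - (\<Sum>k\<in>{1..<B}. u k * S1 k B u) = 0"
proof -
  have "(\<lambda>n. u n * (1 / of_nat n)) sums (\<Sum>k<B. u k * S1 k B u)"
    unfolding S1_eq by (rule sums_digit_split[OF reciprocal_increment_bounds(1,2)])
  moreover have "(\<lambda>n. of_nat B * S_term 0 B u (\<lambda>n. 1 / of_nat n) n) sums (of_nat B * S1 0 B u)"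
    unfolding S1_eq by (intro sums_mult S_term_sums[OF reciprocal_increment_bounds(1,2)])
  then have "(\<lambda>n. u n * (1 / of_nat n)) sums (of_nat B * S1 0 B u)"
    using B by (simp add: S_term_def)
  ultimately have "(\<Sum>k<B. u k * S1 k B u) = of_nat B * S1 0 B u"
    by (rule sums_unique2)
  moreover have "{..<B} = insert 0 {1..<B}" using B by auto
  ultimately show ?thesis by (simp add: algebra_simps)
qed

text \<open>For \<open>n > 0\<close> the block telescopes to 1/(Bn) - 1/(B(n+1)). For
  \<open>n = 0\<close> the \<open>k = 0\<close> term is 0 by division by zero, and the others
  telescope to 1 - 1/B; the \<open>if\<close> records this exceptional block.\<close>

lemma block_sum_telescope:
  "(\<Sum>k<B. 1 / (of_nat (B * n + k) * of_nat (B * n + k + 1)) :: complex) =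
    1 / of_nat B * (1 / (of_nat n * of_nat (n + 1))) + (if n = 0 then 1 - 1 / of_nat B else 0)"
proof -
  note t = reciprocal_diff[where 'a = complex, symmetric]
  show ?thesis
  proof (cases "n = 0")
    case True
    obtain b where b: "B = Suc b" using B by (cases B) auto
    have "(\<Sum>k<B. 1 / (of_nat k * of_nat (k + 1)) :: complex) =
        (\<Sum>k<b. 1 / of_nat (Suc k) - 1 / of_nat (Suc (Suc k)))"
      unfolding b sum.lessThan_Suc_shift
      by (simp add: t[OF zero_less_Suc, simplified])
    also have "\<dots> = 1 - 1 / of_nat B"
      unfolding b by (subst sum_lessThan_telescope'[of "\<lambda>k. 1 / of_nat (Suc k)"]) simp
    finally show ?thesis using True by simp
  next
    case False
    then have "(\<Sum>k<B. 1 / (of_nat (B * n + k) * of_nat (B * n + k + 1)) :: complex) =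
        (\<Sum>k<B. 1 / of_nat (B * n + k) - 1 / of_nat (B * n + Suc k))"
      using B by (intro sum.cong refl) (subst t, simp_all)
    also have "\<dots> = 1 / of_nat (B * n) - 1 / of_nat (B * (n + 1))"
      by (subst sum_lessThan_telescope'[of "\<lambda>k. 1 / of_nat (B * n + k)"]) (simp add: algebra_simps)
    also have "\<dots> = 1 / of_nat B * (1 / of_nat n - 1 / of_nat (Suc n))"
      by (simp only: of_nat_mult) (simp add: right_diff_distrib)
    finally show ?thesis using False t[of n] by simp
  qed
qed

text \<open>The digit split gives \<open>T\<close> as the series of \<open>u n * ?g n\<close>. The
  block sums turn the sum of all \<open>S2 k B u\<close> into T/B + 1 - 1/B, and multiplying by
  \<open>B\<close> gives the claim.\<close>

lemma S2_identity: "(\<Sum>k<B. (of_nat B - u k) * S2 k B u) = of_nat B - 1"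
proof -
  let ?g = "\<lambda>n. 1 / (of_nat n * of_nat (n + 1)) :: complex"
  define T where "T = (\<Sum>k<B. u k * S2 k B u)"
  have "(\<lambda>n. u n * ?g n) sums T"
    unfolding S2_eq T_def by (rule sums_digit_split[OF reciprocal_increment_bounds(3,4)])
  then have "(\<lambda>n. 1 / of_nat B * (u n * ?g n) + (if n = 0 then 1 - 1 / of_nat B else 0))
      sums (1 / of_nat B * T + (1 - 1 / of_nat B))"
    by (intro sums_add sums_mult sums_single)
  moreover have "(\<lambda>n. u n * (\<Sum>k<B. ?g (B * n + k))) sums (\<Sum>k<B. S2 k B u)"
    unfolding S2_eq by (rule sums_block_sum[OF reciprocal_increment_bounds(3,4)])
  \<comment> \<open>The correction carries no factor \<open>u n\<close>: it is nonzero only at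
    \<open>n = 0\<close>, where \<open>u 0 = 1\<close>.\<close>
  moreover have "u n * (\<Sum>k<B. ?g (B * n + k)) =
      1 / of_nat B * (u n * ?g n) + (if n = 0 then 1 - 1 / of_nat B else 0)" for n
    unfolding block_sum_telescope by (simp add: algebra_simps)
  ultimately have "(\<Sum>k<B. S2 k B u) = 1 / of_nat B * T + (1 - 1 / of_nat B)"
    using sums_unique2 by simp
  then have "of_nat B * (\<Sum>k<B. S2 k B u) - T = of_nat B - 1"
    using B by (simp add: field_simps)
  then show ?thesis
    by (simp add: T_def left_diff_distrib sum_subtractf sum_distrib_left)
qed

end

theorem theorem4:
  fixes B :: nat and u f :: "nat \<Rightarrow> complex"
  assumes "B > 1"
    and "strongly_multiplicative B u"
    and "u \<noteq> (\<lambda>n. if n = 0 then 1 else 0)"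
    and "\<And>n. cmod (u n) \<le> 1"
    and "cmod (\<Sum>k\<in>{0..<B}. u k) < real B"
    and "(\<lambda>n. cmod (f (n + 1) - f n)) \<in> O(\<lambda>n. 1 / (real n)\<^sup>2)"
    and "f \<longlonglongrightarrow> 0"
  shows "summable (\<lambda>n. u n * f n) \<and>
    (\<forall>k\<in>{0..B - 1}. summable (S_term k B u f)) \<and>
    ((\<Sum>n. u n * f n) = (\<Sum>k\<in>{0..B - 1}. u k * S k B u f)) \<and>
    summable (\<lambda>n. u n * (\<Sum>k\<in>{0..B - 1}. f (B * n + k))) \<and>
    ((\<Sum>n. u n * (\<Sum>k\<in>{0..B - 1}. f (B * n + k))) = (\<Sum>k\<in>{0..B - 1}. S k B u f)) \<and>
    (\<forall>k\<in>{0..B - 1}. summable (\<lambda>n. S1_term k B u (n + \<delta> k))) \<and>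
    (\<forall>k\<in>{0..B - 1}. summable (\<lambda>n. S2_term k B u (n + \<delta> k))) \<and>
    ((of_nat B - 1) * S1 0 B u - (\<Sum>k\<in>{1..B - 1}. u k * S1 k B u) = 0) \<and>
    ((\<Sum>k\<in>{0..B - 1}. (of_nat B - u k) * S2 k B u) = of_nat B - 1)"
proof -
  interpret bounded_strongly_multiplicative B u
    using assms(1,2,4,5) by unfold_locales (simp_all add: atLeast0LessThan)
  \<comment> \<open>The shifted comparison function is positive at every \<open>n\<close>, including
    0, so a bound valid for all indices becomes possible.\<close>
  have "(\<lambda>n. 1 / (real n)\<^sup>2) \<in> O(\<lambda>n. 1 / (real n + 1)\<^sup>2)" by real_asymp
  with assms(6) have "(\<lambda>n. cmod (f (n + 1) - f n)) \<in> O(\<lambda>n. 1 / (real n + 1)\<^sup>2)"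
    by (rule landau_o.big_trans)
  then obtain c where "\<forall>\<^sub>F n in sequentially. cmod (f (n + 1) - f n) \<le> c / (real n + 1)\<^sup>2"
    by (auto elim!: landau_o.bigE)
  then have "\<forall>\<^sub>F n in sequentially. norm (cmod (f (n + 1) - f n) * (real n + 1)\<^sup>2) \<le> norm c"
    by eventually_elim (simp add: field_simps)
  \<comment> \<open>Finitely many initial terms cannot destroy boundedness, so the eventual bound
    becomes uniform with a possibly larger constant \<open>K\<close>.\<close>
  then have "Bseq (\<lambda>n. cmod (f (n + 1) - f n) * (real n + 1)\<^sup>2)"
    by (rule Bseq_eventually_mono) simp
  then obtain K where "\<forall>n. norm (cmod (f (n + 1) - f n) * (real n + 1)\<^sup>2) \<le> K"
    by (rule BseqE)
  then have K: "cmod (f (Suc n) - f n) \<le> K / (real n + 1)\<^sup>2" for n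
    by (simp add: pos_le_divide_eq)
  have ivl: "{0..B - 1} = {..<B}" "{1..B - 1} = {1..<B}" using assms(1) by auto
  show ?thesis
    unfolding ivl
    by (intro conjI ballI S1_identity S2_identity summable_S_term[OF assms(7) K]
        sums_summable[OF sums_digit_split[OF assms(7) K]]
        sums_summable[OF sums_block_sum[OF assms(7) K]]
        sums_unique[OF sums_digit_split[OF assms(7) K], symmetric]
        sums_unique[OF sums_block_sum[OF assms(7) K], symmetric]
        sums_summable[OF S1_sums] sums_summable[OF S2_sums])
qed

end
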